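(* Let $\lambda$ be an indeterminate and let $m,n$ be integers with $1\le m\le n$. Then the following two identities hold: $$\text{(a)}\quad\sum_{i=m}^n\sum_{j=m}^i(-1)^{n+i}\begin{bmatrix}n\\ i\end{bmatrix}\binom{i}{j}\begin{Bmatrix}j\\ m\end{Bmatrix}\lambda^{i-j}=\frac{n!}{m!}\binom{\lambda}{n-m},$$ $$\text{(b)}\quad\sum_{i=m}^n\sum_{j=m}^i(-1)^{i+j}\begin{bmatrix}n\\ i\end{bmatrix}\binom{i}{j}\begin{Bmatrix}j\\ m\end{Bmatrix}\lambda^{i-j}=\frac{n!}{m!}\binom{\lambda-m}{n-m}(-1)^{m+n}.$$
   Context: For an indeterminate $u$ the falling factorial is $\langle u\rangle_0=1$ and $\langle u\rangle_n=u(u-1)\cdots(u-n+1)$ for $n\ge 1$; the generalized binomial coefficient is $\binom{u}{n}=\langle u\rangle_n/n!$ for integers $n\ge 0$. The unsigned Stirling numbers of the first kind $\begin{bmatrix}n\\ k\end{bmatrix}$ are defined by $\langle u\rangle_n=\sum_{k=0}^n(-1)^{n-k}\begin{bmatrix}n\\ k\end{bmatrix}u^k$, and the Stirling numbers of the second kind $\begin{Bmatrix}n\\ k\end{Bmatrix}$ by $u^n=\sum_{k=0}^n\begin{Bmatrix}n\\ k\end{Bmatrix}\langle u\rangle_k$. When $\lambda$ is specialized to $0$, $\lambda^0=1$. *)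

theory Defs
  imports
    "HOL-Computational_Algebra.Polynomial"
    "HOL-Combinatorics.Stirling"
begin

abbreviation indet :: "'a::comm_semiring_1 poly"
  where "indet \<equiv> [:0, 1:]"

definition falling_factorial :: "'a::comm_ring_1 \<Rightarrow> nat \<Rightarrow> 'a"
  where "falling_factorial u n = (\<Prod>i<n. u - of_nat i)"

(* The library's gbinomial requires a field, so it does not apply to polynomials;
   poly_poly_binomial below states that the two agree after evaluation. *)
definition poly_binomial :: "'a::field_char_0 poly \<Rightarrow> nat \<Rightarrow> 'a poly"
  where "poly_binomial u n = smult (1 / fact n) (falling_factorial u n)"

lemma falling_factorial_0: "falling_factorial u 0 = 1"
  by (simp add: falling_factorial_def)

lemma falling_factorial_Suc:
  "falling_factorial u (Suc n) = falling_factorial u n * (u - of_nat n)"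
  by (simp add: falling_factorial_def)

lemma poly_poly_binomial: "poly (poly_binomial p n) x = poly p x gchoose n"
  by (simp add: poly_binomial_def falling_factorial_def poly_prod gbinomial_prod_rev
      lessThan_atLeast0)

(* The library defines stirling and Stirling by their recurrences. The next two facts
   are the expansions, in the indeterminate, that characterise them as coefficients. *)
lemma falling_factorial_eq_sum_stirling:
  fixes u :: "'a::comm_ring_1"
  shows "falling_factorial u n = (\<Sum>k\<le>n. (-1) ^ (n - k) * of_nat (stirling n k) * u ^ k)"
proof -
  have "falling_factorial u n = (-1) ^ n * pochhammer (- u) n"
    by (induction n) (simp_all add: falling_factorial_def pochhammer_Suc algebra_simps)
  also have "\<dots> = (\<Sum>k\<le>n. (-1) ^ n * (of_nat (stirling n k) * (- u) ^ k))"
    by (simp add: stirling_pochhammer [symmetric] sum_distrib_left)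
  also have "\<dots> = (\<Sum>k\<le>n. (-1) ^ (n - k) * of_nat (stirling n k) * u ^ k)"
  proof (rule sum.cong)
    fix k assume "k \<in> {..n}"
    then have "(-1) ^ n = (-1) ^ (n - k) * ((-1) ^ k :: 'a)"
      by (simp flip: power_add)
    moreover have "(- u) ^ k = (-1) ^ k * u ^ k"
      by (rule power_minus)
    moreover have "(-1) ^ k * ((-1) ^ k :: 'a) = 1"
      by (simp flip: power_mult_distrib)
    ultimately show "(-1) ^ n * (of_nat (stirling n k) * (- u) ^ k)
        = (-1) ^ (n - k) * of_nat (stirling n k) * u ^ k"
      by (simp add: mult_ac)
  qed simp
  finally show ?thesis .
qed

lemma power_eq_sum_Stirling:
  fixes u :: "'a::comm_ring_1"
  shows "u ^ n = (\<Sum>k\<le>n. of_nat (Stirling n k) * falling_factorial u k)"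
proof (induction n)
  case 0
  then show ?case by (simp add: falling_factorial_0)
next
  case (Suc n)
  let ?f = "falling_factorial u"
  have "u ^ Suc n = (\<Sum>k\<le>n. of_nat (Stirling n k) * (?f k * u))"
    by (simp add: Suc sum_distrib_left mult_ac)
  also have "\<dots> = (\<Sum>k\<le>n. of_nat (Stirling n k) * (?f (Suc k) + of_nat k * ?f k))"
    by (simp add: falling_factorial_Suc algebra_simps)
  also have "\<dots> = (\<Sum>k\<le>n. of_nat (Stirling n k) * ?f (Suc k))
      + (\<Sum>k\<le>Suc n. of_nat (k * Stirling n k) * ?f k)"
    by (simp add: sum.distrib algebra_simps)
  also have "(\<Sum>k\<le>Suc n. of_nat (k * Stirling n k) * ?f k)
      = (\<Sum>k\<le>n. of_nat (Suc k * Stirling n (Suc k)) * ?f (Suc k))"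
    by (subst sum.atMost_Suc_shift) simp
  also have "(\<Sum>k\<le>n. of_nat (Stirling n k) * ?f (Suc k)) + \<dots>
      = (\<Sum>k\<le>n. of_nat (Stirling (Suc n) (Suc k)) * ?f (Suc k))"
    by (simp add: sum.distrib [symmetric] algebra_simps)
  also have "\<dots> = (\<Sum>k\<le>Suc n. of_nat (Stirling (Suc n) k) * ?f k)"
    by (subst sum.atMost_Suc_shift) simp
  finally show ?case .
qed

end

theory Submission
  imports Defs
begin

text \<open>
  Both double sums are coefficients in a falling factorial basis. Expand
  \<open>\<langle>\<lambda> + \<epsilon>x\<rangle>\<^sub>n\<close> with \<open>\<epsilon> = 1\<close> or \<open>\<epsilon> = -1\<close>: Stirling numbers of the first kind pass to
  powers of \<open>\<lambda> + \<epsilon>x\<close>, the binomial theorem separates \<open>\<lambda>\<close> from \<open>x\<close>, and Stirling numbers of the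
  second kind return from powers of \<open>x\<close> to the \<open>\<langle>x\<rangle>\<^sub>k\<close>
  (\<open>falling_factorial_expand_via_Stirling\<close>). For \<open>\<epsilon> = 1\<close> the coefficient of \<open>\<langle>x\<rangle>\<^sub>m\<close> is the left
  side of (a), and for \<open>\<epsilon> = -1\<close> it is \<open>(-1)\<^sup>n\<close> times the left side of (b).

  The same coefficients have closed forms. Vandermonde's identity gives
  \<open>\<langle>\<lambda> + x\<rangle>\<^sub>n = \<Sum>\<^sub>k (n choose k) \<langle>\<lambda>\<rangle>\<^bsub>n-k\<^esub> \<langle>x\<rangle>\<^sub>k\<close>, and its counterpart for a difference is
  \<open>\<langle>\<lambda> - x\<rangle>\<^sub>n = \<Sum>\<^sub>k (-1)\<^sup>k (n choose k) \<langle>\<lambda> - k\<rangle>\<^bsub>n-k\<^esub> \<langle>x\<rangle>\<^sub>k\<close>.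
  It remains to compare coefficients. Here \<open>\<lambda>\<close> belongs to the coefficient ring and it suffices
  that \<open>x\<close> runs through the natural numbers, where the expansions are triangular
  (\<open>falling_factorial_coeffs_unique\<close>); so no second indeterminate has to be adjoined.
\<close>

section \<open>Falling factorials\<close>

lemma falling_factorial_rec:
  "falling_factorial u (Suc n) = u * falling_factorial (u - 1) n"
  unfolding falling_factorial_def
  by (subst prod.lessThan_Suc_shift) (simp add: algebra_simps)

lemma falling_factorial_of_nat_eq_0:
  "p < k \<Longrightarrow> falling_factorial (of_nat p) k = 0"
  unfolding falling_factorial_def by (rule prod_zero) auto

lemma falling_factorial_of_nat_self:
  "falling_factorial (of_nat p :: 'a::comm_ring_1) p = of_nat (fact p)"
proof (induction p)
  case (Suc p)
  have "falling_factorial (of_nat (Suc p) :: 'a) (Suc p)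
      = of_nat (Suc p) * falling_factorial (of_nat p) p"
    by (subst falling_factorial_rec) simp
  with Suc show ?case by (simp add: algebra_simps)
qed (simp add: falling_factorial_0)

text \<open>
  At \<open>x = p\<close> every \<open>\<langle>x\<rangle>\<^sub>k\<close> with \<open>k > p\<close> vanishes while \<open>\<langle>p\<rangle>\<^sub>p = p!\<close>, so the values at
  \<open>0, 1, 2, \<dots>\<close> determine the coefficients one after the other.
\<close>

lemma falling_factorial_coeffs_unique:
  fixes a b :: "nat \<Rightarrow> 'a::{idom, ring_char_0}"
  assumes eq: "\<And>p::nat. (\<Sum>k\<le>n. a k * falling_factorial (of_nat p) k)
                        = (\<Sum>k\<le>n. b k * falling_factorial (of_nat p) k)"
    and "m \<le> n"
  shows "a m = b m"
  using \<open>m \<le> n\<close>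
proof (induction m rule: less_induct)
  case (less m)
  let ?f = "falling_factorial (of_nat m :: 'a)"
  have split: "(\<Sum>k\<le>n. c k * ?f k) = (\<Sum>k<m. c k * ?f k) + c m * of_nat (fact m)"
    for c :: "nat \<Rightarrow> 'a"
  proof -
    have "(\<Sum>k\<le>n. c k * ?f k) = (\<Sum>k\<le>m. c k * ?f k)"
      by (rule sum.mono_neutral_right)
         (use less.prems in \<open>auto simp: falling_factorial_of_nat_eq_0\<close>)
    also have "{..m} = insert m {..<m}" by auto
    finally show ?thesis by (simp add: falling_factorial_of_nat_self add.commute)
  qed
  have "(\<Sum>k<m. a k * ?f k) = (\<Sum>k<m. b k * ?f k)"
    using less by (intro sum.cong) auto
  then have "a m * of_nat (fact m) = b m * of_nat (fact m)"
    using eq[of m] unfolding split by simp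
  moreover have "(of_nat (fact m) :: 'a) \<noteq> 0"
    by (simp del: of_nat_fact)
  ultimately show ?case by simp
qed

section \<open>Binomial expansions of falling factorials\<close>

text \<open>Pascal's rule, in the form that drives both inductions below.\<close>

lemma sum_choose_Suc:
  fixes g :: "nat \<Rightarrow> 'a::comm_ring_1"
  shows "(\<Sum>k\<le>Suc n. of_nat (Suc n choose k) * g k)
       = (\<Sum>k\<le>n. of_nat (n choose k) * g k) + (\<Sum>k\<le>n. of_nat (n choose k) * g (Suc k))"
proof -
  have "(\<Sum>k\<le>n. of_nat (n choose k) * g k) = (\<Sum>k\<le>Suc n. of_nat (n choose k) * g k)"
    by (simp add: binomial_eq_0)
  also have "\<dots> = g 0 + (\<Sum>k\<le>n. of_nat (n choose Suc k) * g (Suc k))"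
    by (subst sum.atMost_Suc_shift) simp
  finally show ?thesis
    by (subst sum.atMost_Suc_shift) (simp add: sum.distrib algebra_simps)
qed

text \<open>
  Peeling the first factor off \<open>\<langle>\<lambda>\<rangle>\<close> or off \<open>\<langle>x\<rangle>\<close> leaves in either case the expansion of
  \<open>\<langle>\<lambda> + x - 1\<rangle>\<^sub>n\<close>, so the two halves of Pascal's rule add up to \<open>(\<lambda> + x) \<langle>\<lambda> + x - 1\<rangle>\<^sub>n\<close>.
\<close>

lemma falling_factorial_add:
  fixes l x :: "'a::comm_ring_1"
  shows "falling_factorial (l + x) n
       = (\<Sum>k\<le>n. of_nat (n choose k) * (falling_factorial l (n - k) * falling_factorial x k))"
proof (induction n arbitrary: l x)
  case (Suc n)
  let ?f = "falling_factorial :: 'a \<Rightarrow> nat \<Rightarrow> 'a"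
  have 1: "(\<Sum>k\<le>n. of_nat (n choose k) * (?f l (Suc n - k) * ?f x k)) = l * ?f (l + x - 1) n"
    using Suc[of "l - 1" x]
    by (simp add: Suc_diff_le falling_factorial_rec sum_distrib_left algebra_simps)
  have 2: "(\<Sum>k\<le>n. of_nat (n choose k) * (?f l (Suc n - Suc k) * ?f x (Suc k)))
         = x * ?f (l + x - 1) n"
    using Suc[of l "x - 1"]
    by (simp add: falling_factorial_rec sum_distrib_left algebra_simps)
  show ?case
    unfolding sum_choose_Suc 1 2 by (simp add: falling_factorial_rec algebra_simps)
qed (simp add: falling_factorial_0)

text \<open>
  The last factor of \<open>\<langle>\<lambda> - k\<rangle>\<^bsub>n+1-k\<^esub>\<close> is \<open>\<lambda> - n\<close> for every \<open>k\<close>, and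
  \<open>\<langle>x\<rangle>\<^bsub>k+1\<^esub> = x \<langle>x - 1\<rangle>\<^sub>k\<close>. Since \<open>(\<lambda> - 1) - (x - 1) = \<lambda> - x\<close>, the two halves of Pascal's rule
  are \<open>(\<lambda> - n) \<langle>\<lambda> - x\<rangle>\<^sub>n\<close> and \<open>-x \<langle>\<lambda> - x\<rangle>\<^sub>n\<close>.
\<close>

lemma falling_factorial_diff:
  fixes l x :: "'a::comm_ring_1"
  shows "falling_factorial (l - x) n
       = (\<Sum>k\<le>n. of_nat (n choose k)
            * ((-1) ^ k * falling_factorial (l - of_nat k) (n - k) * falling_factorial x k))"
proof (induction n arbitrary: l x)
  case (Suc n)
  let ?f = "falling_factorial :: 'a \<Rightarrow> nat \<Rightarrow> 'a"
  let ?g = "\<lambda>k. (-1) ^ k * ?f (l - of_nat k) (Suc n - k) * ?f x k"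
  have last: "?f (l - of_nat k) (Suc n - k) = (l - of_nat n) * ?f (l - of_nat k) (n - k)"
    if "k \<le> n" for k
    using that by (simp add: Suc_diff_le falling_factorial_Suc of_nat_diff algebra_simps)
  have 1: "(\<Sum>k\<le>n. of_nat (n choose k) * ?g k) = (l - of_nat n) * ?f (l - x) n"
    unfolding Suc[of l x] sum_distrib_left
    by (intro sum.cong refl) (simp add: last mult_ac)
  have 2: "(\<Sum>k\<le>n. of_nat (n choose k) * ?g (Suc k)) = - x * ?f (l - x) n"
  proof -
    have "l - x = (l - 1) - (x - 1)" by simp
    then have "- x * ?f (l - x) n = - x * ?f ((l - 1) - (x - 1)) n" by simp
    then show ?thesis
      unfolding Suc[of "l - 1" "x - 1"] sum_distrib_left
      by (simp add: falling_factorial_rec[of x] diff_diff_eq mult_ac)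
  qed
  show ?case
    unfolding sum_choose_Suc 1 2 by (simp add: falling_factorial_Suc algebra_simps)
qed (simp add: falling_factorial_0)

section \<open>Expansion through powers\<close>

text \<open>
  The sign \<open>\<epsilon>\<close> is kept as a parameter \<open>e\<close>, so that one expansion serves both identities. The
  summation ranges start at \<open>k\<close> because \<open>Stirling j k\<close> vanishes for \<open>j < k\<close>.
\<close>

lemma falling_factorial_expand_via_Stirling:
  fixes l e x :: "'a::comm_ring_1"
  shows "falling_factorial (l + e * x) n
       = (\<Sum>k\<le>n. (\<Sum>i=k..n. \<Sum>j=k..i. (-1) ^ (n + i) * of_nat (stirling n i)
              * of_nat (i choose j) * of_nat (Stirling j k) * e ^ j * l ^ (i - j))
            * falling_factorial x k)"
proof -
  let ?f = "falling_factorial x"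
  let ?T = "\<lambda>i j k. (-1) ^ (n + i) * of_nat (stirling n i) * of_nat (i choose j)
              * of_nat (Stirling j k) * e ^ j * l ^ (i - j)"
  have pow: "x ^ j = (\<Sum>k\<le>n. of_nat (Stirling j k) * ?f k)" if "j \<le> n" for j
    unfolding power_eq_sum_Stirling[of x j]
    by (rule sum.mono_neutral_left) (use that in auto)
  have sign: "(-1 :: 'a) ^ (n - i) = (-1) ^ (n + i)" if "i \<le> n" for i
    using that by (simp add: minus_one_power_iff)
  have binom: "(l + e * x) ^ i = (\<Sum>j\<le>i. of_nat (i choose j) * e ^ j * l ^ (i - j) * x ^ j)" for i
    by (subst add.commute) (simp add: binomial_ring power_mult_distrib mult_ac)
  have "falling_factorial (l + e * x) n
      = (\<Sum>i\<le>n. (-1) ^ (n - i) * of_nat (stirling n i) * (l + e * x) ^ i)"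
    by (rule falling_factorial_eq_sum_stirling)
  also have "\<dots> = (\<Sum>i\<le>n. \<Sum>j\<le>i. \<Sum>k\<le>n. ?T i j k * ?f k)"
  proof (intro sum.cong refl)
    fix i assume "i \<in> {..n}"
    then have "i \<le> n" by simp
    have "(l + e * x) ^ i
        = (\<Sum>j\<le>i. of_nat (i choose j) * e ^ j * l ^ (i - j)
             * (\<Sum>k\<le>n. of_nat (Stirling j k) * ?f k))"
      unfolding binom using \<open>i \<le> n\<close> by (intro sum.cong refl) (simp add: pow)
    then show "(-1) ^ (n - i) * of_nat (stirling n i) * (l + e * x) ^ i
        = (\<Sum>j\<le>i. \<Sum>k\<le>n. ?T i j k * ?f k)"
      unfolding sign[OF \<open>i \<le> n\<close>] by (simp only: sum_distrib_left mult_ac)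
  qed
  also have "\<dots> = (\<Sum>i\<le>n. \<Sum>k\<le>n. \<Sum>j\<le>i. ?T i j k * ?f k)"
    by (intro sum.cong refl sum.swap)
  also have "\<dots> = (\<Sum>k\<le>n. \<Sum>i\<le>n. \<Sum>j\<le>i. ?T i j k * ?f k)"
    by (rule sum.swap)
  also have "\<dots> = (\<Sum>k\<le>n. (\<Sum>i\<le>n. \<Sum>j\<le>i. ?T i j k) * ?f k)"
    by (simp add: sum_distrib_right)
  also have "\<dots> = (\<Sum>k\<le>n. (\<Sum>i=k..n. \<Sum>j=k..i. ?T i j k) * ?f k)"
  proof -
    have inner: "(\<Sum>j\<le>i. ?T i j k) = (\<Sum>j=k..i. ?T i j k)" for i k
      by (rule sum.mono_neutral_right) auto
    have outer: "(\<Sum>i\<le>n. \<Sum>j=k..i. ?T i j k) = (\<Sum>i=k..n. \<Sum>j=k..i. ?T i j k)" for k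
      by (rule sum.mono_neutral_right) auto
    show ?thesis unfolding inner outer ..
  qed
  finally show ?thesis .
qed

section \<open>The two identities\<close>

text \<open>
  Since \<open>n! / (m! (n - m)!) = n choose m\<close>, this brings the right-hand sides of both identities, up
  to their signs, into the shape of the coefficients in the two binomial expansions.
\<close>

lemma smult_poly_binomial:
  fixes u :: "'a::field_char_0 poly"
  assumes "m \<le> n"
  shows "smult (fact n / fact m) (poly_binomial u (n - m))
       = of_nat (n choose m) * falling_factorial u (n - m)"
proof -
  have "fact n / fact m * (1 / fact (n - m)) = (of_nat (n choose m) :: 'a)"
    using assms by (simp add: binomial_fact)
  then show ?thesis
    by (simp add: poly_binomial_def of_nat_poly)
qed

theorem theorem6:
  fixes m n :: nat
  assumes "1 \<le> m" and "m \<le> n"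
  shows "(\<Sum>i=m..n. \<Sum>j=m..i.
             (-1) ^ (n + i) * of_nat (stirling n i) * of_nat (i choose j) * of_nat (Stirling j m)
               * indet ^ (i - j))
           = smult (fact n / fact m) (poly_binomial (indet :: 'a::field_char_0 poly) (n - m))
       \<and> (\<Sum>i=m..n. \<Sum>j=m..i.
             (-1) ^ (i + j) * of_nat (stirling n i) * of_nat (i choose j) * of_nat (Stirling j m)
               * indet ^ (i - j))
           = smult (fact n / fact m)
               (poly_binomial (indet - of_nat m :: 'a poly) (n - m)) * (-1) ^ (m + n)"
proof -
  let ?X = "indet :: 'a poly"
  let ?C = "\<lambda>(e :: 'a poly) k. \<Sum>i=k..n. \<Sum>j=k..i. (-1) ^ (n + i) * of_nat (stirling n i)
              * of_nat (i choose j) * of_nat (Stirling j k) * e ^ j * ?X ^ (i - j)"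
  have a: "?C 1 m = of_nat (n choose m) * falling_factorial ?X (n - m)"
  proof (rule falling_factorial_coeffs_unique[OF _ \<open>m \<le> n\<close>])
    fix p :: nat
    show "(\<Sum>k\<le>n. ?C 1 k * falling_factorial (of_nat p) k)
        = (\<Sum>k\<le>n. of_nat (n choose k) * falling_factorial ?X (n - k)
             * falling_factorial (of_nat p) k)"
      using falling_factorial_expand_via_Stirling[of ?X 1 "of_nat p" n]
        falling_factorial_add[of ?X "of_nat p" n]
      by (simp only: mult_1 mult.assoc)
  qed
  have b: "?C (-1) m = of_nat (n choose m) * ((-1) ^ m * falling_factorial (?X - of_nat m) (n - m))"
  proof (rule falling_factorial_coeffs_unique[OF _ \<open>m \<le> n\<close>])
    fix p :: nat
    show "(\<Sum>k\<le>n. ?C (-1) k * falling_factorial (of_nat p) k)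
        = (\<Sum>k\<le>n. of_nat (n choose k) * ((-1) ^ k * falling_factorial (?X - of_nat k) (n - k))
             * falling_factorial (of_nat p) k)"
      using falling_factorial_expand_via_Stirling[of ?X "-1" "of_nat p" n]
        falling_factorial_diff[of ?X "of_nat p" n]
      by (simp only: mult_minus1 add_uminus_conv_diff mult.assoc)
  qed
  \<comment> \<open>The factor \<open>(-1)\<^sup>j\<close> is \<open>\<epsilon>\<^sup>j\<close>; the global \<open>(-1)\<^sup>n\<close> becomes part of the sign \<open>(-1)\<^bsup>m+n\<^esup>\<close>.\<close>
  have sign: "(-1 :: 'a poly) ^ (i + j) = (-1) ^ n * ((-1) ^ (n + i) * (-1) ^ j)" for i j
    by (simp add: minus_one_power_iff)
  have b_lhs: "(\<Sum>i=m..n. \<Sum>j=m..i. (-1) ^ (i + j) * of_nat (stirling n i) * of_nat (i choose j)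
                 * of_nat (Stirling j m) * ?X ^ (i - j)) = (-1) ^ n * ?C (-1) m"
    unfolding sum_distrib_left by (intro sum.cong refl) (subst sign, simp only: mult_ac)
  show ?thesis
    unfolding b_lhs b smult_poly_binomial[OF \<open>m \<le> n\<close>]
    using a by (simp only: power_one mult_1 power_add mult_ac simp_thms)
qed

end
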